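(* Let $\gamma:S^1\rightarrow\mathbb{R}^2$ be a Jordan curve and $\theta\in\mathbb{R}$. If there is no special corner of $\gamma$ of angle $\theta$, then there exists an inscribed rhombus of $\gamma$ of angle $\theta$.
   Context: A Jordan curve is a continuous injective map $\gamma:S^1\to\mathbb{R}^2$; no regularity is assumed. Its image is denoted $\operatorname{im}(\gamma)$. A line of angle $\theta$ ($\theta\in\mathbb{R}$) is a line in $\mathbb{R}^2$ of the form $x\sin\theta-y\cos\theta=\text{constant}$, i.e. a line making angle $\theta$ with the $x$-axis in the anti-clockwise sense. A special corner of $\gamma$ of angle $\theta$ is a point $p\in \operatorname{im}(\gamma)$ such that both the line of angle $\theta$ through $p$ and the line of angle $\theta+\frac{\pi}{2}$ through $p$ intersect $\operatorname{im}(\gamma)$ only at $p$. A rhombus of angle $\theta$ is a rhombus in $\mathbb{R}^2$ whose two diagonals lie on lines of angles $\theta$ and $\theta+\frac{\pi}{2}$ respectively (so "angle $\theta$" and "angle $\theta+\frac{\pi}{2}$" are the same concept for rhombi). An inscribed rhombus of $\gamma$ is a set of 4 distinct points in $\operatorname{im}(\gamma)$ which are the vertices of a rhombus in $\mathbb{R}^2$; it is an inscribed rhombus of angle $\theta$ if that rhombus is a rhombus of angle $\theta$. *)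

theory Defs
  imports "HOL-Analysis.Analysis"
begin

abbreviation unit_circle :: "complex set" where
  "unit_circle \<equiv> sphere 0 1"

(* Maps on the circle are total functions on complex; only their values on unit_circle matter. *)
definition jordan_curve :: "(complex \<Rightarrow> real^2) \<Rightarrow> bool" where
  "jordan_curve \<gamma> \<longleftrightarrow> continuous_on unit_circle \<gamma> \<and> inj_on \<gamma> unit_circle"

definition curve_im :: "(complex \<Rightarrow> real^2) \<Rightarrow> (real^2) set" where
  "curve_im \<gamma> = \<gamma> ` unit_circle"

definition line_of_angle :: "real \<Rightarrow> (real^2) set \<Rightarrow> bool" where
  "line_of_angle \<theta> L \<longleftrightarrow> (\<exists>k. L = {p. p $ 1 * sin \<theta> - p $ 2 * cos \<theta> = k})"

(* Through each point there is exactly one line of a given angle. *)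
definition special_corner :: "(complex \<Rightarrow> real^2) \<Rightarrow> real \<Rightarrow> real^2 \<Rightarrow> bool" where
  "special_corner \<gamma> \<theta> p \<longleftrightarrow>
     p \<in> curve_im \<gamma> \<and>
     (\<forall>L. line_of_angle \<theta> L \<and> p \<in> L \<longrightarrow> L \<inter> curve_im \<gamma> = {p}) \<and>
     (\<forall>L. line_of_angle (\<theta> + pi / 2) L \<and> p \<in> L \<longrightarrow> L \<inter> curve_im \<gamma> = {p})"

(* The vertices are listed in cyclic order, so the diagonals are ac and bd. In the plane,
   four distinct points with equal consecutive distances always form a non-degenerate rhombus. *)
definition rhombus :: "real^2 \<Rightarrow> real^2 \<Rightarrow> real^2 \<Rightarrow> real^2 \<Rightarrow> bool" where
  "rhombus a b c d \<longleftrightarrow>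
     distinct [a, b, c, d] \<and> dist a b = dist b c \<and> dist b c = dist c d \<and> dist c d = dist d a"

definition rhombus_of_angle ::
    "real \<Rightarrow> real^2 \<Rightarrow> real^2 \<Rightarrow> real^2 \<Rightarrow> real^2 \<Rightarrow> bool" where
  "rhombus_of_angle \<theta> a b c d \<longleftrightarrow>
     rhombus a b c d \<and>
     (\<exists>L M. line_of_angle \<theta> L \<and> line_of_angle (\<theta> + pi / 2) M \<and>
        (closed_segment a c \<subseteq> L \<and> closed_segment b d \<subseteq> M \<or>
         closed_segment a c \<subseteq> M \<and> closed_segment b d \<subseteq> L))"

definition inscribed_rhombus_of_angle ::
    "(complex \<Rightarrow> real^2) \<Rightarrow> real \<Rightarrow> (real^2) set \<Rightarrow> bool" where
  "inscribed_rhombus_of_angle \<gamma> \<theta> R \<longleftrightarrow>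
     R \<subseteq> curve_im \<gamma> \<and> (\<exists>a b c d. R = {a, b, c, d} \<and> rhombus_of_angle \<theta> a b c d)"

end

theory Submission
  imports Defs "HOL-Complex_Analysis.Contour_Integration"
begin

text \<open>
  Let \<open>X = along \<theta>\<close> and \<open>Y = across \<theta>\<close> be the rotated Cartesian coordinates for which the lines of
  angle \<open>\<theta>\<close> are the level sets of \<open>Y\<close> and the lines of angle \<open>\<theta> + pi / 2\<close> those of \<open>X\<close>.
  A rhombus of angle \<open>\<theta>\<close> then consists of a chord \<open>p q\<close> on which \<open>Y\<close> is constant together with a
  chord \<open>r s\<close> on which \<open>X\<close> is constant, such that the two chords share their midpoint. Let \<open>p\<close> and \<open>q\<close> each run along an arc of the curve from a minimum to
  a maximum of \<open>Y\<close>, and \<open>r\<close> and \<open>s\<close> each along an arc from a minimum to a maximum of \<open>X\<close>. The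
  condition on the four points is equivalent to the system
  \<open>2 Y(p) = Y(r) + Y(s)\<close>, \<open>2 Y(q) = Y(r) + Y(s)\<close>, \<open>2 X(r) = X(p) + X(q)\<close>, \<open>2 X(s) = X(p) + X(q)\<close>,
  in which each of the four points belongs to one equation, and the difference of its two sides has
  opposite signs at the two ends of the arc of that point. So the Poincare-Miranda theorem on
  the four-dimensional cube gives a solution
  (lemma \<open>crossing_chords_with_common_midpoint\<close>).

  This solution might be degenerate, with \<open>p = q\<close> or \<open>r = s\<close>. The arcs can be chosen so that the
  two arcs for \<open>Y\<close> meet only where \<open>Y\<close> has its unique minimum or its unique maximum, and
  likewise for \<open>X\<close> (lemma \<open>two_arcs_between_disjoint_sets\<close>). If \<open>p = q\<close>, then \<open>Y\<close> has a unique extremum at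
  \<open>p\<close> while \<open>Y(r) + Y(s) = 2 Y(p)\<close>, which forces \<open>r = s = p\<close>; then \<open>p\<close> is a unique extremum
  of \<open>X\<close> as well, that is, a special corner. The case \<open>r = s\<close> is symmetric. Hence a curve
  without special corner has a proper solution.
\<close>

section \<open>A zero theorem on the cube\<close>

text \<open>
  The Poincare-Miranda theorem. The map \<open>x \<mapsto> x - F x\<close>, clamped coordinatewise to the cube, has
  a fixed point by Brouwer; the sign conditions on the faces exclude that the clamping took effect there.
\<close>

lemma poincare_miranda:
  fixes F :: "real^'n \<Rightarrow> real^'n"
  assumes cont: "continuous_on (cbox (vec 0) (vec 1)) F"
    and lower: "\<And>x i. x \<in> cbox (vec 0) (vec 1) \<Longrightarrow> x $ i = 0 \<Longrightarrow> F x $ i \<le> 0"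
    and upper: "\<And>x i. x \<in> cbox (vec 0) (vec 1) \<Longrightarrow> x $ i = 1 \<Longrightarrow> F x $ i \<ge> 0"
  obtains x where "x \<in> cbox (vec 0) (vec 1)" "F x = 0"
proof -
  let ?C = "cbox (vec 0) (vec 1) :: (real^'n) set"
  define G where "G x = (\<chi> i. max 0 (min 1 (x $ i - F x $ i)))" for x
  have "vec 0 \<in> ?C"
    by (simp add: mem_box_cart)
  then have ne: "?C \<noteq> {}"
    by blast
  have "continuous_on ?C G"
    unfolding G_def using cont by (intro continuous_intros)
  moreover have "G \<in> ?C \<rightarrow> ?C"
    by (auto simp: G_def mem_box_cart)
  ultimately obtain x where x: "x \<in> ?C" and fixed: "G x = x"
    using brouwer[of ?C G] ne by (metis compact_cbox convex_box(1))
  have "F x $ i = 0" for i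
  proof -
    have "max 0 (min 1 (x $ i - F x $ i)) = x $ i"
      using fixed by (metis G_def vec_lambda_beta)
    moreover have "0 \<le> x $ i" "x $ i \<le> 1"
      using x by (auto simp: mem_box_cart)
    ultimately show ?thesis
      using lower[OF x, of i] upper[OF x, of i] by (auto simp: max_def min_def split: if_splits)
  qed
  then show thesis
    using that[OF x] by (simp add: vec_eq_iff)
qed

section \<open>Chords with a common midpoint\<close>

definition minimizers :: "('a \<Rightarrow> real) \<Rightarrow> 'a set \<Rightarrow> 'a set" where
  "minimizers f S = {z \<in> S. \<forall>w\<in>S. f z \<le> f w}"

definition maximizers :: "('a \<Rightarrow> real) \<Rightarrow> 'a set \<Rightarrow> 'a set" where
  "maximizers f S = {z \<in> S. \<forall>w\<in>S. f w \<le> f z}"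

text \<open>The function is not required to be monotone along the path; only the ends are prescribed.\<close>

definition rising_path :: "('a::topological_space \<Rightarrow> real) \<Rightarrow> 'a set \<Rightarrow> (real \<Rightarrow> 'a) \<Rightarrow> bool" where
  "rising_path f S g \<longleftrightarrow> path g \<and> path_image g \<subseteq> S \<and>
     pathstart g \<in> minimizers f S \<and> pathfinish g \<in> maximizers f S"

text \<open>
  Moving a single one of the four points need not change the sign of \<open>X p + X q - 2 X r\<close> or of
  \<open>Y r + Y s - 2 Y p\<close>. An equivalent system is therefore solved instead, in which the \<open>i\<close>-th equation
  compares a value at the \<open>i\<close>-th point with an average of two values: its two sides compare in opposite ways
  at the two extrema joined by the \<open>i\<close>-th path.
\<close>

lemma crossing_chords_with_common_midpoint:
  fixes X Y :: "'a::topological_space \<Rightarrow> real"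
  assumes X: "continuous_on S X" and Y: "continuous_on S Y"
    and a: "rising_path Y S a" and b: "rising_path Y S b"
    and c: "rising_path X S c" and d: "rising_path X S d"
  obtains p q r s where "p \<in> path_image a" "q \<in> path_image b" "r \<in> path_image c" "s \<in> path_image d"
    "Y p = Y q" "X r = X s" "X p + X q = 2 * X r" "Y r + Y s = 2 * Y p"
proof -
  define F :: "real^4 \<Rightarrow> real^4" where
    "F x = (\<chi> i. if i = 1 then 2 * Y (a (x $ 1)) - Y (c (x $ 3)) - Y (d (x $ 4))
             else if i = 2 then 2 * Y (b (x $ 2)) - Y (c (x $ 3)) - Y (d (x $ 4))
             else if i = 3 then 2 * X (c (x $ 3)) - X (a (x $ 1)) - X (b (x $ 2))
             else 2 * X (d (x $ 4)) - X (a (x $ 1)) - X (b (x $ 2)))" for x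
  have F: "F x $ 1 = 2 * Y (a (x $ 1)) - Y (c (x $ 3)) - Y (d (x $ 4))"
    "F x $ 2 = 2 * Y (b (x $ 2)) - Y (c (x $ 3)) - Y (d (x $ 4))"
    "F x $ 3 = 2 * X (c (x $ 3)) - X (a (x $ 1)) - X (b (x $ 2))"
    "F x $ 4 = 2 * X (d (x $ 4)) - X (a (x $ 1)) - X (b (x $ 2))" for x
    by (simp_all add: F_def)
  let ?C = "cbox (vec 0) (vec 1) :: (real^4) set"
  have unit: "x $ i \<in> {0..1}" if "x \<in> ?C" for x i
    using that by (auto simp: mem_box_cart)
  have in_S: "g t \<in> S" if "rising_path h S g" "t \<in> {0..1}" for h g t
    using that by (auto simp: rising_path_def path_image_def)
  have cont: "continuous_on ?C (\<lambda>x. h (g (x $ i)))"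
    if "continuous_on S h" "rising_path k S g" for h k :: "'a \<Rightarrow> real" and g i
  proof -
    have "continuous_on {0..1} (\<lambda>t. h (g t))"
      using that in_S[OF that(2)] by (auto simp: rising_path_def path_def intro: continuous_on_compose2)
    then show ?thesis
      by (rule continuous_on_compose2) (use unit in \<open>auto intro!: continuous_intros\<close>)
  qed
  have start: "h (g 0) \<le> h z" and finish: "h z \<le> h (g 1)" if "rising_path h S g" "z \<in> S" for h g z
    using that by (auto simp: rising_path_def minimizers_def maximizers_def pathstart_def pathfinish_def)
  have sign: "(x $ i = 0 \<longrightarrow> F x $ i \<le> 0) \<and> (x $ i = 1 \<longrightarrow> F x $ i \<ge> 0)" if "x \<in> ?C" for x i
  proof -
    note S = in_S[OF a unit[OF that, of 1]] in_S[OF b unit[OF that, of 2]]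
      in_S[OF c unit[OF that, of 3]] in_S[OF d unit[OF that, of 4]]
    have "\<forall>i. (x $ i = 0 \<longrightarrow> F x $ i \<le> 0) \<and> (x $ i = 1 \<longrightarrow> F x $ i \<ge> 0)"
      unfolding forall_4 F
      using start[OF a S(3)] start[OF a S(4)] start[OF b S(3)] start[OF b S(4)]
        start[OF c S(1)] start[OF c S(2)] start[OF d S(1)] start[OF d S(2)]
        finish[OF a S(3)] finish[OF a S(4)] finish[OF b S(3)] finish[OF b S(4)]
        finish[OF c S(1)] finish[OF c S(2)] finish[OF d S(1)] finish[OF d S(2)]
      by auto
    then show ?thesis
      by blast
  qed
  have "\<forall>i. continuous_on ?C (\<lambda>x. F x $ i)"
    unfolding forall_4 F
    by (intro conjI continuous_on_diff continuous_on_mult continuous_on_const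
        cont[OF X a] cont[OF Y a] cont[OF X b] cont[OF Y b]
        cont[OF X c] cont[OF Y c] cont[OF X d] cont[OF Y d])
  then have "continuous_on ?C (\<lambda>x. F x $ i)" for i
    by blast
  then have "continuous_on ?C (\<lambda>x. \<chi> i. F x $ i)"
    by (rule continuous_on_vec_lambda)
  then have "continuous_on ?C F"
    by simp
  then obtain x where x: "x \<in> ?C" "F x = 0"
    using sign by (metis poincare_miranda)
  then have "F x $ 1 = 0" "F x $ 2 = 0" "F x $ 3 = 0" "F x $ 4 = 0"
    by simp_all
  then show thesis
    unfolding F using unit[OF x(1)]
    by (intro that[of "a (x $ 1)" "b (x $ 2)" "c (x $ 3)" "d (x $ 4)"])
       (auto simp: path_image_def)
qed

section \<open>Choosing the arcs\<close>

text \<open>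
  Cut the loop open at a point \<open>h 0 = h 1\<close> of \<open>P\<close>. Take parameters \<open>v < w\<close> of two points of \<open>Q\<close>, and the
  parameter \<open>m > 0\<close> of a second point of \<open>P\<close>; allow \<open>v = w\<close> or \<open>m = 0\<close> only when \<open>Q\<close> or \<open>P\<close> is a
  singleton. In each of the three positions of \<open>m\<close> relative to \<open>v\<close> and \<open>w\<close>, two of the
  intervals between neighbouring parameters each join a point of \<open>P\<close> to a point of \<open>Q\<close>, and
  they share no point of the loop except through \<open>v = w\<close> or \<open>m = 0\<close>.
\<close>

lemma two_arcs_between_disjoint_sets:
  fixes g :: "real \<Rightarrow> 'a::real_normed_vector"
  assumes g: "simple_path g" "pathfinish g = pathstart g"
    and P: "P \<subseteq> path_image g" "P \<noteq> {}" and Q: "Q \<subseteq> path_image g" "Q \<noteq> {}" and PQ: "P \<inter> Q = {}"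
  obtains a b where "path a" "path_image a \<subseteq> path_image g" "pathstart a \<in> P" "pathfinish a \<in> Q"
    "path b" "path_image b \<subseteq> path_image g" "pathstart b \<in> P" "pathfinish b \<in> Q"
    "\<And>z. z \<in> path_image a \<Longrightarrow> z \<in> path_image b \<Longrightarrow> P = {z} \<or> Q = {z}"
proof -
  obtain p where "p \<in> P"
    using P by blast
  then have "p \<in> g ` {0..1}"
    using P by (auto simp: path_image_def)
  then obtain u where u: "u \<in> {0..1}" "g u \<in> P"
    using \<open>p \<in> P\<close> by blast
  define h where "h = shiftpath u g"
  have h: "simple_path h" "path_image h = path_image g" "h 0 = g u" "h 1 = g u"
    using u g pathstart_shiftpath[of u g] pathfinish_shiftpath[of u g]
    by (auto simp: h_def simple_path_shiftpath path_image_shiftpath pathstart_def pathfinish_def)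
  have inj: "s = t \<or> s = 0 \<and> t = 1 \<or> s = 1 \<and> t = 0" if "h s = h t" "s \<in> {0..1}" "t \<in> {0..1}" for s t
    using h(1) that by (auto simp: simple_path_def loop_free_def)
  have h0: "h 0 \<in> P" "h 1 \<in> P"
    using h u by auto
  have param: "\<exists>t\<in>{0<..<1}. h t = z" if z: "z \<in> path_image g" "z \<noteq> h 0" for z
  proof -
    have "z \<in> h ` {0..1}"
      using z(1) h(2) by (simp add: path_image_def)
    then obtain t where "t \<in> {0..1}" "h t = z"
      by blast
    moreover have "t \<noteq> 0" "t \<noteq> 1"
      using calculation z(2) h(3,4) by auto
    ultimately show ?thesis
      by (intro bexI[of _ t]) auto
  qed
  obtain m where m: "m \<in> {0..<1}" "h m \<in> P" "m = 0 \<Longrightarrow> P = {h 0}"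
  proof (cases "P = {h 0}")
    case True
    then show ?thesis
      using that[of 0] h0 by auto
  next
    case False
    then obtain p where "p \<in> P" "p \<noteq> h 0"
      using h0 by blast
    then show ?thesis
      using param[of p] that P(1) by (metis atLeastLessThan_iff greaterThanLessThan_iff less_eq_real_def order_less_irrefl subsetD)
  qed
  obtain v w where vw: "0 < v" "v \<le> w" "w < 1" "h v \<in> Q" "h w \<in> Q" "v = w \<Longrightarrow> Q = {h v}"
  proof -
    obtain q where q: "q \<in> Q"
      using Q by blast
    obtain q' where q': "q' \<in> Q" "q' = q \<Longrightarrow> Q = {q}"
      using q by blast
    have "q \<noteq> h 0" "q' \<noteq> h 0"
      using q q' h0 PQ by auto
    then obtain t t' where "t \<in> {0<..<1}" "h t = q" "t' \<in> {0<..<1}" "h t' = q'"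
      using param Q(1) q q'(1) by (meson subsetD)
    then show ?thesis
      using that[of t t'] that[of t' t] q q' by (cases "t \<le> t'") auto
  qed
  note result = that
  have "m \<noteq> v" "m \<noteq> w"
    using m(2) vw(4,5) PQ by auto
  \<comment> \<open>reduces the choice of arcs to the choice of their parameter intervals, from \<open>i\<close> to \<open>j\<close> and from \<open>k\<close> to \<open>l\<close>\<close>
  have arcs: thesis
    if i: "i \<in> {0..1}" "h i \<in> P" "j \<in> {0..1}" "h j \<in> Q" "k \<in> {0..1}" "h k \<in> P" "l \<in> {0..1}" "h l \<in> Q"
      and meet: "\<And>s t. s \<in> closed_segment i j \<Longrightarrow> t \<in> closed_segment k l \<Longrightarrow> h s = h t \<Longrightarrow>
        P = {h s} \<or> Q = {h s}" for i j k l
  proof (rule result[of "subpath i j h" "subpath k l h"])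
    have "path h"
      using h(1) by (rule simple_path_imp_path)
    then show "path (subpath i j h)" "path (subpath k l h)"
      using i by simp_all
    show "path_image (subpath i j h) \<subseteq> path_image g" "path_image (subpath k l h) \<subseteq> path_image g"
      using i path_image_subpath_subset unfolding h(2)[symmetric] by blast+
    show "P = {z} \<or> Q = {z}" if z: "z \<in> path_image (subpath i j h)" "z \<in> path_image (subpath k l h)" for z
    proof -
      obtain s where "s \<in> closed_segment i j" "z = h s"
        using z(1) by (auto simp: path_image_subpath_gen)
      moreover obtain t where "t \<in> closed_segment k l" "z = h t"
        using z(2) by (auto simp: path_image_subpath_gen)
      ultimately show ?thesis
        using meet[of s t] by simp
    qed
  qed (use i in \<open>auto simp: pathstart_def pathfinish_def subpath_def\<close>)
  consider "m < v" | "v < m" "m < w" | "w < m"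
    using \<open>m \<noteq> v\<close> \<open>m \<noteq> w\<close> by linarith
  then show thesis
  proof cases
    case 1
    show thesis
    proof (rule arcs[of m v 1 w])
      fix s t assume st: "s \<in> closed_segment m v" "t \<in> closed_segment 1 w" "h s = h t"
      then have "s \<in> {m..v}" "t \<in> {w..1}"
        using 1 vw by (auto simp: closed_segment_eq_real_ivl)
      then have "s = t \<and> v = w \<and> s = v \<or> s = 0 \<and> m = 0"
        using inj[OF st(3)] m(1) vw(1-3) 1 by force
      then show "P = {h s} \<or> Q = {h s}"
        using m(3) vw(6) by metis
    qed (use 1 m(1,2) vw(1-5) h0 in auto)
  next
    case 2
    show thesis
    proof (rule arcs[of 0 v m w])
      fix s t assume st: "s \<in> closed_segment 0 v" "t \<in> closed_segment m w" "h s = h t"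
      then have "s \<in> {0..v}" "t \<in> {m..w}"
        using 2 vw by (auto simp: closed_segment_eq_real_ivl)
      then have False
        using inj[OF st(3)] m(1) vw(1-3) 2 by force
      then show "P = {h s} \<or> Q = {h s}" ..
    qed (use 2 m(1,2) vw(1-5) h0 in auto)
  next
    case 3
    show thesis
    proof (rule arcs[of 0 v m w])
      fix s t assume st: "s \<in> closed_segment 0 v" "t \<in> closed_segment m w" "h s = h t"
      then have "s \<in> {0..v}" "t \<in> {w..m}"
        using 3 vw by (auto simp: closed_segment_eq_real_ivl)
      then have "v = w \<and> s = v"
        using inj[OF st(3)] m(1) vw(1-3) 3 by force
      then show "P = {h s} \<or> Q = {h s}"
        using vw(6) by metis
    qed (use 3 m(1,2) vw(1-5) h0 in auto)
  qed
qed

lemma two_rising_paths: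
  fixes g :: "real \<Rightarrow> 'a::real_normed_vector" and f :: "'a \<Rightarrow> real"
  assumes g: "simple_path g" "pathfinish g = pathstart g"
    and f: "continuous_on (path_image g) f" and nonconst: "\<And>k. f ` path_image g \<noteq> {k}"
  obtains a b where "rising_path f (path_image g) a" "rising_path f (path_image g) b"
    "\<And>z. z \<in> path_image a \<Longrightarrow> z \<in> path_image b \<Longrightarrow>
      minimizers f (path_image g) = {z} \<or> maximizers f (path_image g) = {z}"
proof -
  let ?S = "path_image g"
  have S: "compact ?S" "?S \<noteq> {}"
    using g(1) by (auto simp: compact_simple_path_image)
  have min: "minimizers f ?S \<noteq> {}"
    using continuous_attains_inf[OF S f] by (auto simp: minimizers_def)
  have max: "maximizers f ?S \<noteq> {}"
    using continuous_attains_sup[OF S f] by (auto simp: maximizers_def)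
  have disj: "minimizers f ?S \<inter> maximizers f ?S = {}"
  proof (rule ccontr)
    assume "minimizers f ?S \<inter> maximizers f ?S \<noteq> {}"
    then obtain z where "z \<in> ?S" and "\<forall>w\<in>?S. f z \<le> f w" "\<forall>w\<in>?S. f w \<le> f z"
      unfolding minimizers_def maximizers_def by blast
    then have "f ` ?S = {f z}"
      by (force intro: antisym)
    then show False
      using nonconst by blast
  qed
  have sub: "minimizers f ?S \<subseteq> ?S" "maximizers f ?S \<subseteq> ?S"
    by (auto simp: minimizers_def maximizers_def)
  show thesis
  proof (rule two_arcs_between_disjoint_sets[OF g sub(1) min sub(2) max disj])
    fix a b
    assume ab: "path a" "path_image a \<subseteq> ?S" "pathstart a \<in> minimizers f ?S" "pathfinish a \<in> maximizers f ?S"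
      "path b" "path_image b \<subseteq> ?S" "pathstart b \<in> minimizers f ?S" "pathfinish b \<in> maximizers f ?S"
      and meet: "\<And>z. z \<in> path_image a \<Longrightarrow> z \<in> path_image b \<Longrightarrow> minimizers f ?S = {z} \<or> maximizers f ?S = {z}"
    have "rising_path f ?S a" "rising_path f ?S b"
      using ab by (simp_all add: rising_path_def)
    then show thesis
      using meet by (rule that)
  qed
qed

text \<open>
  A value strictly between those at the parameters \<open>0\<close> and \<open>1/2\<close> is attained on each half of the loop.
  This excludes a Jordan curve inside a line, on which one of the coordinates would be constant.
\<close>

lemma no_simple_loop_in_line:
  fixes g :: "real \<Rightarrow> real"
  assumes "simple_path g"
  shows "pathfinish g \<noteq> pathstart g"
proof
  assume loop: "pathfinish g = pathstart g"
  have inj: "s = t \<or> s = 0 \<and> t = 1 \<or> s = 1 \<and> t = 0" if "g s = g t" "s \<in> {0..1}" "t \<in> {0..1}" for s t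
    using assms that by (auto simp: simple_path_def loop_free_def)
  have "continuous_on {0..1} g"
    using assms by (simp add: simple_path_def path_def)
  then have cont: "continuous_on (closed_segment 0 (1/2)) g" "continuous_on (closed_segment (1/2) 1) g"
    by (auto simp: closed_segment_eq_real_ivl intro: continuous_on_subset)
  have "g 0 \<noteq> g (1/2)"
    using inj[of 0 "1/2"] by auto
  define k where "k = (g 0 + g (1/2)) / 2"
  have k: "k \<in> closed_segment (g 0) (g (1/2))" "k \<noteq> g 0" "k \<noteq> g (1/2)"
    using \<open>g 0 \<noteq> g (1/2)\<close> by (auto simp: k_def closed_segment_eq_real_ivl field_simps)
  obtain s where s: "s \<in> closed_segment 0 (1/2)" "g s = k"
    using IVT'_closed_segment_real[OF k(1) cont(1)] by blast
  have "k \<in> closed_segment (g (1/2)) (g 1)"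
    using k(1) loop by (simp add: pathstart_def pathfinish_def closed_segment_commute)
  then obtain t where t: "t \<in> closed_segment (1/2) 1" "g t = k"
    using IVT'_closed_segment_real[OF _ cont(2)] by blast
  have "s \<noteq> 1/2" "t \<noteq> 1/2" "s \<noteq> 0"
    using s(2) t(2) k by metis+
  then show False
    using inj[of s t] s t by (auto simp: closed_segment_eq_real_ivl)
qed

text \<open>
  A point \<open>z\<close> violating the last hypothesis plays the role of a special corner for the coordinates
  \<open>X\<close> and \<open>Y\<close>. A common unique extremum of both is such a point, and every degenerate
  pair of chords produces one.
\<close>

lemma crossing_chords_of_simple_loop:
  fixes g :: "real \<Rightarrow> 'a::real_normed_vector" and X Y :: "'a \<Rightarrow> real"
  assumes g: "simple_path g" "pathfinish g = pathstart g"
    and X: "continuous_on (path_image g) X" and Y: "continuous_on (path_image g) Y"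
    and inj: "inj_on (\<lambda>z. (X z, Y z)) (path_image g)"
    and no_corner: "\<And>z. z \<in> path_image g \<Longrightarrow>
      \<exists>w\<in>path_image g. w \<noteq> z \<and> (X w = X z \<or> Y w = Y z)"
  obtains p q r s where "p \<in> path_image g" "q \<in> path_image g" "r \<in> path_image g" "s \<in> path_image g"
    "p \<noteq> q" "r \<noteq> s" "Y p = Y q" "X r = X s" "X p + X q = 2 * X r" "Y r + Y s = 2 * Y p"
proof -
  let ?S = "path_image g"
  have nonconst: "f ` ?S \<noteq> {k}"
    if "continuous_on ?S h" "inj_on (\<lambda>z. (h z, f z)) ?S" for f h :: "'a \<Rightarrow> real" and k
  proof
    assume "f ` ?S = {k}"
    then have "f z = k" if "z \<in> ?S" for z
      using that by blast
    then have "inj_on h ?S"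
      using that(2) by (simp add: inj_on_def)
    then have "simple_path (h \<circ> g)"
      using g(1) that(1) by (simp add: simple_path_continuous_image)
    then show False
      using no_simple_loop_in_line[of "h \<circ> g"] g(2) by (simp add: pathstart_compose pathfinish_compose)
  qed
  have "inj_on (\<lambda>z. (Y z, X z)) ?S"
    using inj by (auto simp: inj_on_def)
  then obtain c d where c: "rising_path X ?S c" "rising_path X ?S d"
    and cd: "\<And>z. z \<in> path_image c \<Longrightarrow> z \<in> path_image d \<Longrightarrow> minimizers X ?S = {z} \<or> maximizers X ?S = {z}"
    using two_rising_paths[OF g X nonconst[OF Y]] by blast
  obtain a b where a: "rising_path Y ?S a" "rising_path Y ?S b"
    and ab: "\<And>z. z \<in> path_image a \<Longrightarrow> z \<in> path_image b \<Longrightarrow> minimizers Y ?S = {z} \<or> maximizers Y ?S = {z}"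
    using two_rising_paths[OF g Y nonconst[OF X inj]] by blast
  obtain p q r s where on: "p \<in> path_image a" "q \<in> path_image b" "r \<in> path_image c" "s \<in> path_image d"
    and eq: "Y p = Y q" "X r = X s" "X p + X q = 2 * X r" "Y r + Y s = 2 * Y p"
    using crossing_chords_with_common_midpoint[OF X Y a c] by blast
  have S: "p \<in> ?S" "q \<in> ?S" "r \<in> ?S" "s \<in> ?S"
    using on a c by (auto simp: rising_path_def)
  have extreme: "w = z" if "minimizers f ?S = {z} \<or> maximizers f ?S = {z}" "w \<in> ?S" "f w = f z" for f w z
  proof -
    have "z \<in> minimizers f ?S \<Longrightarrow> w \<in> minimizers f ?S" "z \<in> maximizers f ?S \<Longrightarrow> w \<in> maximizers f ?S"
      using that(2,3) by (simp_all add: minimizers_def maximizers_def)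
    then show ?thesis
      using that(1) by auto
  qed
  \<comment> \<open>an extreme value is an average of two values only if both are extreme\<close>
  have split: "u = z \<and> w = z"
    if "minimizers f ?S = {z} \<or> maximizers f ?S = {z}" "u \<in> ?S" "w \<in> ?S" "f u + f w = 2 * f z" for f u w z
  proof -
    have "f z \<le> f u \<and> f z \<le> f w \<or> f u \<le> f z \<and> f w \<le> f z"
      using that(1,2,3) by (auto simp: minimizers_def maximizers_def set_eq_iff)
    then have "f u = f z" "f w = f z"
      using that(4) by auto
    then show ?thesis
      using extreme[OF that(1)] that(2,3) by blast
  qed
  have corner: False if "minimizers X ?S = {z} \<or> maximizers X ?S = {z}"
    "minimizers Y ?S = {z} \<or> maximizers Y ?S = {z}" "z \<in> ?S" for z
    using extreme[OF that(1)] extreme[OF that(2)] no_corner[OF that(3)] by blast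
  have "p \<noteq> q"
  proof
    assume "p = q"
    then have Yp: "minimizers Y ?S = {p} \<or> maximizers Y ?S = {p}"
      using ab on by auto
    then have "r = p \<and> s = p"
      using split[OF Yp S(3,4)] eq by auto
    then show False
      using corner[OF _ Yp S(1)] cd on by auto
  qed
  moreover have "r \<noteq> s"
  proof
    assume "r = s"
    then have Xr: "minimizers X ?S = {r} \<or> maximizers X ?S = {r}"
      using cd on by auto
    then have "p = r \<and> q = r"
      using split[OF Xr S(1,2)] eq by auto
    then show False
      using corner[OF Xr _ S(3)] ab on by auto
  qed
  ultimately show thesis
    using that[OF S] eq by auto
qed

section \<open>Rotated coordinates\<close>

definition along :: "real \<Rightarrow> real^2 \<Rightarrow> real" where
  "along \<theta> p = p $ 1 * cos \<theta> + p $ 2 * sin \<theta>"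

definition across :: "real \<Rightarrow> real^2 \<Rightarrow> real" where
  "across \<theta> p = p $ 1 * sin \<theta> - p $ 2 * cos \<theta>"

lemma line_of_angle_iff: "line_of_angle \<theta> L \<longleftrightarrow> (\<exists>k. L = {p. across \<theta> p = k})"
  by (simp add: line_of_angle_def across_def)

lemma across_quarter_turn: "across (\<theta> + pi / 2) = along \<theta>"
  by (simp add: fun_eq_iff across_def along_def sin_add cos_add)

lemma continuous_on_across: "continuous_on S (across \<theta>)"
  unfolding across_def by (intro continuous_intros)

lemma continuous_on_along: "continuous_on S (along \<theta>)"
  unfolding along_def by (intro continuous_intros)

lemma convex_across_level: "convex {p. across \<theta> p = k}"
proof -
  have "{p. across \<theta> p = k} = {p. vector [sin \<theta>, - cos \<theta>] \<bullet> p = k}"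
    by (auto simp: across_def inner_vec_def sum_2 algebra_simps)
  then show ?thesis
    by (simp add: convex_hyperplane)
qed

lemma dist_eq_along_across:
  "dist p q = sqrt ((along \<theta> p - along \<theta> q)\<^sup>2 + (across \<theta> p - across \<theta> q)\<^sup>2)"
proof -
  have rot: "(u * c + v * s)\<^sup>2 + (u * s - v * c)\<^sup>2 = (u\<^sup>2 + v\<^sup>2) * (s\<^sup>2 + c\<^sup>2)" for u v s c :: real
    by (simp add: power2_eq_square algebra_simps)
  have "(along \<theta> p - along \<theta> q)\<^sup>2 + (across \<theta> p - across \<theta> q)\<^sup>2 = (p$1 - q$1)\<^sup>2 + (p$2 - q$2)\<^sup>2"
    using rot[of "p$1 - q$1" "cos \<theta>" "p$2 - q$2" "sin \<theta>"]
    by (simp add: along_def across_def algebra_simps)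
  then show ?thesis
    by (simp add: dist_vec_def L2_set_def sum_2 dist_real_def)
qed

lemma along_across_eqI:
  assumes "along \<theta> p = along \<theta> q" "across \<theta> p = across \<theta> q"
  shows "p = q"
  using dist_eq_along_across[of p q \<theta>] assms by simp

lemma rhombus_of_angle_from_chords:
  assumes ne: "p \<noteq> q" "r \<noteq> s"
    and Y: "across \<theta> p = across \<theta> q" and X: "along \<theta> r = along \<theta> s"
    and mid: "along \<theta> p + along \<theta> q = 2 * along \<theta> r" "across \<theta> r + across \<theta> s = 2 * across \<theta> p"
  shows "rhombus_of_angle \<theta> p r q s"
proof -
  have X_ne: "along \<theta> p \<noteq> along \<theta> q"
    using ne(1) Y along_across_eqI by blast
  have "distinct [p, r, q, s]"
    using ne X X_ne mid by auto
  moreover have "dist p r = dist r q" "dist r q = dist q s" "dist q s = dist s p"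
  proof -
    have q: "along \<theta> q = 2 * along \<theta> r - along \<theta> p" and s: "across \<theta> s = 2 * across \<theta> p - across \<theta> r"
      using mid by auto
    show "dist p r = dist r q" "dist r q = dist q s" "dist q s = dist s p"
      unfolding dist_eq_along_across[of _ _ \<theta>] q s Y[symmetric] X[symmetric]
      by (simp_all add: power2_eq_square algebra_simps)
  qed
  moreover have "closed_segment p q \<subseteq> {z. across \<theta> z = across \<theta> p}"
    using Y by (intro closed_segment_subset convex_across_level) auto
  moreover have "closed_segment r s \<subseteq> {z. across (\<theta> + pi / 2) z = along \<theta> r}"
    using X by (intro closed_segment_subset convex_across_level) (auto simp: across_quarter_turn)
  ultimately show ?thesis
    unfolding rhombus_of_angle_def rhombus_def line_of_angle_iff by blast
qed

lemma special_cornerI: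
  assumes "p \<in> curve_im \<gamma>"
    and "\<And>w. w \<in> curve_im \<gamma> \<Longrightarrow> along \<theta> w = along \<theta> p \<or> across \<theta> w = across \<theta> p \<Longrightarrow> w = p"
  shows "special_corner \<gamma> \<theta> p"
  using assms by (auto simp: special_corner_def line_of_angle_iff across_quarter_turn)

theorem proposition1p6:
  fixes \<gamma> :: "complex \<Rightarrow> real^2" and \<theta> :: real
  assumes "jordan_curve \<gamma>"
    and "\<nexists>p. special_corner \<gamma> \<theta> p"
  shows "\<exists>R. inscribed_rhombus_of_angle \<gamma> \<theta> R"
proof -
  define g where "g = \<gamma> \<circ> circlepath 0 1"
  have g: "simple_path g" "pathfinish g = pathstart g" "path_image g = curve_im \<gamma>"
    using assms(1)
    by (auto simp: g_def jordan_curve_def curve_im_def simple_path_continuous_image simple_path_circlepath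
        pathstart_compose pathfinish_compose path_image_compose)
  have "inj_on (\<lambda>z. (along \<theta> z, across \<theta> z)) (curve_im \<gamma>)"
    by (auto simp: inj_on_def intro: along_across_eqI)
  moreover have "\<exists>w\<in>curve_im \<gamma>. w \<noteq> z \<and> (along \<theta> w = along \<theta> z \<or> across \<theta> w = across \<theta> z)"
    if "z \<in> curve_im \<gamma>" for z
    using assms(2) special_cornerI[OF that] by blast
  ultimately obtain p q r s
    where on: "p \<in> curve_im \<gamma>" "q \<in> curve_im \<gamma>" "r \<in> curve_im \<gamma>" "s \<in> curve_im \<gamma>"
      and chords: "p \<noteq> q" "r \<noteq> s" "across \<theta> p = across \<theta> q" "along \<theta> r = along \<theta> s"
        "along \<theta> p + along \<theta> q = 2 * along \<theta> r" "across \<theta> r + across \<theta> s = 2 * across \<theta> p"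
    by (rule crossing_chords_of_simple_loop[OF g(1,2) continuous_on_along continuous_on_across, unfolded g(3)])
  have "rhombus_of_angle \<theta> p r q s"
    using chords by (rule rhombus_of_angle_from_chords)
  with on have "inscribed_rhombus_of_angle \<gamma> \<theta> {p, r, q, s}"
    unfolding inscribed_rhombus_of_angle_def by blast
  then show ?thesis ..
qed

end
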